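(* Let $\mathsf{P}$ be a problem. Then $\mathsf{P}$ is computably true if and only if there exists a first-order problem $\mathsf{Q}$ such that $\mathsf{P} \leq_{\mathrm{W}} \mathsf{Q}$.
   Context: A problem is a partial multifunction $\mathsf{P} :\subseteq \omega^\omega \rightrightarrows \omega^\omega$. Each $f \in \mathrm{dom}(\mathsf{P})$ (so $\mathsf{P}(f) \neq \emptyset$) is a $\mathsf{P}$-instance, and each $g \in \mathsf{P}(f)$ is a $\mathsf{P}$-solution to $f$. The set $\omega$ is embedded in $\omega^\omega$ by identifying $x \in \omega$ with the $f \in \omega^\omega$ such that $f(0)=x$ and $f(y)=0$ for all $y>0$. For $f,g \in \omega^\omega$, $\langle f,g\rangle$ is the Turing join. Turing functionals are regarded as partial maps $\omega^\omega \to \omega^\omega$, and $\Psi(f,g)$ means $\Psi(\langle f,g\rangle)$. Weihrauch reducibility: $\mathsf{Q} \leq_{\mathrm{W}} \mathsf{P}$ if there are Turing functionals $\Phi,\Psi$ such that for all $f \in \mathrm{dom}(\mathsf{Q})$ we have $\Phi(f) \in \mathrm{dom}(\mathsf{P})$, and for every $g \in \mathsf{P}(\Phi(f))$ we have $\Psi(f,g) \in \mathsf{Q}(f)$. A problem $\mathsf{Q}$ is first-order if $\mathsf{Q}(f) \subseteq \omega$ for all $f \in \mathrm{dom}(\mathsf{Q})$. A problem $\mathsf{P}$ is computably true if every $\mathsf{P}$-instance $f$ has an $f$-computable $\mathsf{P}$-solution. *)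

theory Defs
  imports Main "HOL-Library.Nat_Bijection"
begin

type_synonym baire = "nat \<Rightarrow> nat"

(* Indices for the partial recursive functionals with a function oracle: Kleene's schemes,
   presented for unary functions by means of the (primitive recursive) Cantor pairing
   prod_encode of HOL-Library.Nat_Bijection. *)
datatype index =
    Zero
  | Succ
  | Fst
  | Snd
  | Oracle
  | Pairing index index
  | Compose index index
  | PrimRec index index
  | Minimise index

primrec eval :: "baire \<Rightarrow> index \<Rightarrow> nat \<rightharpoonup> nat" where
  "eval f Zero = (\<lambda>n. Some 0)"
| "eval f Succ = (\<lambda>n. Some (Suc n))"
| "eval f Fst = (\<lambda>n. Some (fst (prod_decode n)))"
| "eval f Snd = (\<lambda>n. Some (snd (prod_decode n)))"
| "eval f Oracle = (\<lambda>n. Some (f n))"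
| "eval f (Pairing a b) = (\<lambda>n.
     case (eval f a n, eval f b n) of
       (Some u, Some v) \<Rightarrow> Some (prod_encode (u, v))
     | _ \<Rightarrow> None)"
| "eval f (Compose a b) = (\<lambda>n. Option.bind (eval f b n) (eval f a))"
| "eval f (PrimRec a b) = (\<lambda>n.
     case prod_decode n of (x, k) \<Rightarrow>
       rec_nat (eval f a x)
         (\<lambda>i r. Option.bind r (\<lambda>v. eval f b (prod_encode (x, prod_encode (i, v))))) k)"
  (* Search for the least zero of k \<mapsto> eval f a (prod_encode (n, k)); every earlier value
     must be defined and nonzero. *)
| "eval f (Minimise a) = (\<lambda>n.
     if \<exists>k. eval f a (prod_encode (n, k)) = Some 0 \<and>
            (\<forall>j<k. eval f a (prod_encode (n, j)) \<noteq> None)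
     then Some (LEAST k. eval f a (prod_encode (n, k)) = Some 0)
     else None)"

(* The partial map on Baire space given by an index is defined at f exactly when the
   computed function is total. *)
definition functional :: "index \<Rightarrow> baire \<rightharpoonup> baire" where
  "functional e f =
     (if \<forall>n. eval f e n \<noteq> None then Some (\<lambda>n. the (eval f e n)) else None)"

definition turing_functional :: "(baire \<rightharpoonup> baire) \<Rightarrow> bool" where
  "turing_functional \<Phi> \<longleftrightarrow> (\<exists>e. \<Phi> = functional e)"

definition computable_from :: "baire \<Rightarrow> baire \<Rightarrow> bool" where
  "computable_from f g \<longleftrightarrow> (\<exists>\<Phi>. turing_functional \<Phi> \<and> \<Phi> f = Some g)"

definition turing_join :: "baire \<Rightarrow> baire \<Rightarrow> baire" where
  "turing_join f g = (\<lambda>n. if even n then f (n div 2) else g (n div 2))"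

definition nat_embed :: "nat \<Rightarrow> baire" where
  "nat_embed x = (\<lambda>y. if y = 0 then x else 0)"

(* A partial multifunction, with the empty value standing for "undefined". *)
type_synonym problem = "baire \<Rightarrow> baire set"

definition instances :: "problem \<Rightarrow> baire set" where
  "instances P = {f. P f \<noteq> {}}"

definition weihrauch_le :: "problem \<Rightarrow> problem \<Rightarrow> bool"  (infix "\<le>\<^sub>W" 50) where
  "Q \<le>\<^sub>W P \<longleftrightarrow>
     (\<exists>\<Phi> \<Psi>. turing_functional \<Phi> \<and> turing_functional \<Psi> \<and>
        (\<forall>f \<in> instances Q. \<exists>h. \<Phi> f = Some h \<and> h \<in> instances P \<and>
           (\<forall>g \<in> P h. \<exists>k. \<Psi> (turing_join f g) = Some k \<and> k \<in> Q f)))"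

definition first_order :: "problem \<Rightarrow> bool" where
  "first_order Q \<longleftrightarrow> (\<forall>f \<in> instances Q. Q f \<subseteq> range nat_embed)"

definition computably_true :: "problem \<Rightarrow> bool" where
  "computably_true P \<longleftrightarrow> (\<forall>f \<in> instances P. \<exists>g \<in> P f. computable_from f g)"

end

theory Submission
  imports Defs
begin

text \<open>
  If \<open>P\<close> is computably true, let \<open>Q\<close> map each instance \<open>f\<close> of \<open>P\<close> to the codes of those functionals
  that send \<open>f\<close> to a solution. Then \<open>P \<le>\<^sub>W Q\<close> with the identity as forward functional and a universal
  functional as backward one. The universal functional iterates the transition function of a machine
  that works on a value and a stack of pending instructions: one transition is a mere case
  distinction, so no course-of-values recursion or bounded search is needed.

  Conversely, a natural number \<open>x\<close> adds nothing to the computational power of \<open>f\<close>: the join of \<open>f\<close>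
  and \<open>x\<close> is computable from \<open>f\<close>, and may be substituted for the oracle in the backward functional.
\<close>

abbreviation pr :: "nat \<Rightarrow> nat \<Rightarrow> nat" where "pr x y \<equiv> prod_encode (x, y)"
abbreviation lft :: "nat \<Rightarrow> nat" where "lft n \<equiv> fst (prod_decode n)"
abbreviation rgt :: "nat \<Rightarrow> nat" where "rgt n \<equiv> snd (prod_decode n)"

lemma pr_0_0: "pr 0 0 = 0"
  by (simp add: prod_encode_def)

section \<open>Total functions recursive in the oracle\<close>

text \<open>The index is chosen before the oracle. This uniformity in \<open>f\<close> is what
  allows such an \<open>F\<close> to be built into one universal index.\<close>

definition oracle_recursive :: "(baire \<Rightarrow> nat \<Rightarrow> nat) \<Rightarrow> bool" where
  "oracle_recursive F \<longleftrightarrow> (\<exists>e. \<forall>f n. eval f e n = Some (F f n))"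

lemma oracle_recursiveI: "(\<And>f n. eval f e n = Some (F f n)) \<Longrightarrow> oracle_recursive F"
  unfolding oracle_recursive_def by blast

lemma oracle_recursive_id: "oracle_recursive (\<lambda>f n. n)"
  by (rule oracle_recursiveI[of "Pairing Fst Snd"]) simp

lemma oracle_recursive_comp:
  assumes "oracle_recursive F" "oracle_recursive G"
  shows "oracle_recursive (\<lambda>f n. F f (G f n))"
proof -
  obtain a b where "\<And>f n. eval f a n = Some (F f n)" "\<And>f n. eval f b n = Some (G f n)"
    using assms unfolding oracle_recursive_def by blast
  then show ?thesis
    by (intro oracle_recursiveI[of "Compose a b"]) simp
qed

lemma oracle_recursive_Suc:
  assumes "oracle_recursive G" shows "oracle_recursive (\<lambda>f n. Suc (G f n))"
  by (rule oracle_recursive_comp[OF oracle_recursiveI[of Succ] assms]) simp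

lemma oracle_recursive_lft:
  assumes "oracle_recursive G" shows "oracle_recursive (\<lambda>f n. lft (G f n))"
  by (rule oracle_recursive_comp[OF oracle_recursiveI[of Fst] assms]) simp

lemma oracle_recursive_rgt:
  assumes "oracle_recursive G" shows "oracle_recursive (\<lambda>f n. rgt (G f n))"
  by (rule oracle_recursive_comp[OF oracle_recursiveI[of Snd] assms]) simp

lemma oracle_recursive_oracle:
  assumes "oracle_recursive G" shows "oracle_recursive (\<lambda>f n. f (G f n))"
  by (rule oracle_recursive_comp[OF oracle_recursiveI[of Oracle] assms]) simp

lemma oracle_recursive_pr:
  assumes "oracle_recursive G" "oracle_recursive H"
  shows "oracle_recursive (\<lambda>f n. pr (G f n) (H f n))"
proof -
  obtain a b where "\<And>f n. eval f a n = Some (G f n)" "\<And>f n. eval f b n = Some (H f n)"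
    using assms unfolding oracle_recursive_def by blast
  then show ?thesis
    by (intro oracle_recursiveI[of "Pairing a b"]) simp
qed

lemma oracle_recursive_const: "oracle_recursive (\<lambda>f n. c)"
proof (induction c)
  case 0
  show ?case by (rule oracle_recursiveI[of Zero]) simp
qed (rule oracle_recursive_Suc)

lemma oracle_recursive_rec_nat:
  assumes "oracle_recursive A" "oracle_recursive (\<lambda>f m. B f (lft m) (lft (rgt m)) (rgt (rgt m)))"
    and "oracle_recursive K"
  shows "oracle_recursive (\<lambda>f n. rec_nat (A f n) (B f n) (K f n))"
proof -
  obtain a b k where a: "\<And>f n. eval f a n = Some (A f n)"
    and b: "\<And>f m. eval f b m = Some (B f (lft m) (lft (rgt m)) (rgt (rgt m)))"
    and k: "\<And>f n. eval f k n = Some (K f n)"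
    using assms unfolding oracle_recursive_def by blast
  have "rec_nat (eval f a n) (\<lambda>i r. Option.bind r (\<lambda>v. eval f b (pr n (pr i v)))) m
      = Some (rec_nat (A f n) (B f n) m)" for f n m
    by (induction m) (simp_all add: a b)
  then show ?thesis
    by (intro oracle_recursiveI[of "Compose (PrimRec a b) (Pairing (Pairing Fst Snd) k)"])
      (simp add: k)
qed

lemma oracle_recursive_pred:
  assumes "oracle_recursive G" shows "oracle_recursive (\<lambda>f n. G f n - 1)"
proof -
  have "m - 1 = rec_nat 0 (\<lambda>i r. i) m" for m :: nat
    by (cases m) auto
  then show ?thesis
    by (simp only:) (intro oracle_recursive_rec_nat assms oracle_recursive_const
        oracle_recursive_lft oracle_recursive_rgt oracle_recursive_id)
qed

lemma oracle_recursive_if0: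
  assumes "oracle_recursive G" "oracle_recursive A" "oracle_recursive B"
  shows "oracle_recursive (\<lambda>f n. if G f n = 0 then A f n else B f n)"
proof -
  have eq: "(if m = 0 then x else y) = rec_nat x (\<lambda>i r. y) m" for m x y :: nat
    by (cases m) auto
  have "oracle_recursive (\<lambda>f m. B f (lft m))"
    by (intro oracle_recursive_comp[OF assms(3)] oracle_recursive_lft oracle_recursive_id)
  then show ?thesis
    unfolding eq by (intro oracle_recursive_rec_nat assms)
qed

text \<open>Equality with a constant is tested by counting down, one predecessor for each stage of
  an induction on \<open>c\<close>.\<close>

lemma oracle_recursive_if:
  assumes "oracle_recursive G" "oracle_recursive A" "oracle_recursive B"
  shows "oracle_recursive (\<lambda>f n. if G f n = c then A f n else B f n)"
  using assms(1)
proof (induction c arbitrary: G)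
  case 0
  then show ?case using assms by (intro oracle_recursive_if0)
next
  case (Suc c)
  have "(if m = Suc c then x else y) = (if m = 0 then y else if m - 1 = c then x else y)"
    for m x y :: nat by auto
  then show ?case
    by (simp only:) (intro oracle_recursive_if0 Suc oracle_recursive_pred assms)
qed

lemmas oracle_recursive_intros =
  oracle_recursive_id oracle_recursive_const oracle_recursive_Suc oracle_recursive_lft
  oracle_recursive_rgt oracle_recursive_pr oracle_recursive_pred oracle_recursive_if
  oracle_recursive_rec_nat oracle_recursive_oracle

lemma oracle_recursive_double:
  assumes "oracle_recursive G" shows "oracle_recursive (\<lambda>f n. 2 * G f n)"
proof -
  have "2 * m = rec_nat 0 (\<lambda>i r. Suc (Suc r)) m" for m :: nat
    by (induction m) auto
  then show ?thesis
    by (simp only:) (intro oracle_recursive_intros assms)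
qed

lemma oracle_recursive_mod2:
  assumes "oracle_recursive G" shows "oracle_recursive (\<lambda>f n. G f n mod 2)"
proof -
  have "m mod 2 = rec_nat 0 (\<lambda>i r. if r = 0 then 1 else 0) m" for m :: nat
    by (induction m) (auto simp: mod_Suc)
  then show ?thesis
    by (simp only:) (intro oracle_recursive_intros assms)
qed

lemma oracle_recursive_div2:
  assumes "oracle_recursive G" shows "oracle_recursive (\<lambda>f n. G f n div 2)"
proof -
  have "m div 2 = rec_nat 0 (\<lambda>i r. if i mod 2 = 0 then r else Suc r) m" for m :: nat
    by (induction m) (auto simp: div_Suc mod_Suc)
  then show ?thesis
    by (simp only:) (intro oracle_recursive_intros oracle_recursive_mod2 assms)
qed

section \<open>A universal functional\<close>

text \<open>Tags start at 1 because tag 0 signals halting.\<close>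

primrec code :: "index \<Rightarrow> nat" where
  "code Zero = pr 1 0"
| "code Succ = pr 2 0"
| "code Fst = pr 3 0"
| "code Snd = pr 4 0"
| "code Oracle = pr 5 0"
| "code (Pairing a b) = pr 6 (pr (code a) (code b))"
| "code (Compose a b) = pr 7 (pr (code a) (code b))"
| "code (PrimRec a b) = pr 8 (pr (code a) (code b))"
| "code (Minimise a) = pr 9 (code a)"

text \<open>
  A state is a pair of a stack and a current value; a nonempty stack is a pair of an instruction and
  the remaining stack, and an instruction is a pair of a tag and an argument. Besides the codes of
  indices, the instructions are

  \<^item> 10: having computed the first component of a pairing at \<open>n\<close>, turn to the second one, \<open>b\<close>
    (argument: \<open>b\<close> and \<open>n\<close>);
  \<^item> 11: pair the argument with the value;
  \<^item> 12: apply the step \<open>b\<close> of a primitive recursion (argument: \<open>b\<close>, parameter, counter);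
  \<^item> 13: with value \<open>(n, k)\<close>, search for a zero of the argument at \<open>n\<close> from \<open>k\<close> onwards;
  \<^item> 14: test the value computed in such a search (argument: \<open>a\<close>, \<open>n\<close>, \<open>k\<close>).

  As \<open>pr 0 0 = 0\<close>, the empty stack \<open>0\<close> has an instruction with tag \<open>0\<close> on top, which means halting.
\<close>

definition step :: "baire \<Rightarrow> nat \<Rightarrow> nat" where
  "step f s =
    (let v = rgt s; rest = rgt (lft s); tag = lft (lft (lft s)); p = rgt (lft (lft s)) in
     if tag = 0 then s
     else if tag = 1 then pr rest 0
     else if tag = 2 then pr rest (Suc v)
     else if tag = 3 then pr rest (lft v)
     else if tag = 4 then pr rest (rgt v)
     else if tag = 5 then pr rest (f v)
     else if tag = 6 then pr (pr (lft p) (pr (pr 10 (pr (rgt p) v)) rest)) v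
     else if tag = 7 then pr (pr (rgt p) (pr (lft p) rest)) v
     else if tag = 8 then
       (if rgt v = 0 then pr (pr (lft p) rest) (lft v)
        else pr (pr (pr 8 p) (pr (pr 12 (pr (rgt p) (pr (lft v) (rgt v - 1)))) rest))
               (pr (lft v) (rgt v - 1)))
     else if tag = 9 then pr (pr (pr 13 p) rest) (pr v 0)
     else if tag = 10 then pr (pr (lft p) (pr (pr 11 v) rest)) (rgt p)
     else if tag = 11 then pr rest (pr p v)
     else if tag = 12 then pr (pr (lft p) rest) (pr (lft (rgt p)) (pr (rgt (rgt p)) v))
     else if tag = 13 then pr (pr p (pr (pr 14 (pr p v)) rest)) v
     else
       (if v = 0 then pr rest (rgt (rgt p))
        else pr (pr (pr 13 (lft p)) rest) (pr (lft (rgt p)) (Suc (rgt (rgt p))))))"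

section \<open>Correctness of the machine on convergent computations\<close>

inductive reaches :: "baire \<Rightarrow> nat \<Rightarrow> nat \<Rightarrow> bool" for f where
  refl: "reaches f s s"
| step: "reaches f (step f s) s' \<Longrightarrow> reaches f s s'"

lemma reaches_trans: "reaches f s s' \<Longrightarrow> reaches f s' s'' \<Longrightarrow> reaches f s s''"
  by (induction rule: reaches.induct) (auto intro: reaches.step)

lemma reaches_imp_funpow: "reaches f s s' \<Longrightarrow> \<exists>t. (step f ^^ t) s = s'"
proof (induction rule: reaches.induct)
  case (refl s)
  show ?case by (rule exI[of _ 0]) simp
next
  case (step s s')
  then obtain t where "(step f ^^ t) (step f s) = s'" by blast
  then show ?case by (intro exI[of _ "Suc t"]) (simp add: funpow_swap1)
qed

text \<open>\<open>A\<close> and \<open>B\<close> are what the induction hypotheses of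
  \<open>reaches_eval\<close> supply. \<open>rest\<close> varies in the induction because the value
  at \<open>i\<close> is computed while instruction 12 is pending.\<close>

lemma reaches_rec_nat:
  assumes A: "\<And>v rest. eval f a x = Some v \<Longrightarrow> reaches f (pr (pr (code a) rest) x) (pr rest v)"
    and B: "\<And>m v rest. eval f b m = Some v \<Longrightarrow> reaches f (pr (pr (code b) rest) m) (pr rest v)"
    and "rec_nat (eval f a x) (\<lambda>i r. Option.bind r (\<lambda>v. eval f b (pr x (pr i v)))) k = Some v"
  shows "reaches f (pr (pr (code (PrimRec a b)) rest) (pr x k)) (pr rest v)"
  using assms(3)
proof (induction k arbitrary: v rest)
  case 0
  then show ?case by (auto intro: reaches.step simp: step_def A)
next
  case (Suc i)
  then obtain r
    where r: "rec_nat (eval f a x) (\<lambda>i r. Option.bind r (\<lambda>v. eval f b (pr x (pr i v)))) i = Some r"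
      and v: "eval f b (pr x (pr i r)) = Some v"
    by (auto simp: bind_eq_Some_conv)
  let ?rest = "pr (pr 12 (pr (code b) (pr x i))) rest"
  have "reaches f (pr ?rest r) (pr rest v)"
    by (rule reaches.step) (simp add: step_def B v)
  with Suc.IH[OF r, of ?rest]
  have "reaches f (pr (pr (code (PrimRec a b)) ?rest) (pr x i)) (pr rest v)"
    by (rule reaches_trans)
  \<comment> \<open>The pattern limits \<open>intro\<close> to one transition: the new goal starts
    from a \<open>step f\<close> term and no longer matches.\<close>
  then show ?case
    by (intro reaches.step[of _ "pr (pr _ rest) _"]) (simp add: step_def)
qed

text \<open>Downward induction from the zero \<open>k\<close>: at an earlier \<open>j\<close> the
  test meets a nonzero value and passes on to \<open>Suc j\<close>.\<close>

lemma reaches_search: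
  assumes A: "\<And>m v rest. eval f a m = Some v \<Longrightarrow> reaches f (pr (pr (code a) rest) m) (pr rest v)"
    and zero: "eval f a (pr n k) = Some 0"
    and pos: "\<And>j. j < k \<Longrightarrow> \<exists>u. eval f a (pr n j) = Some u \<and> u \<noteq> 0"
    and "j \<le> k"
  shows "reaches f (pr (pr (pr 13 (code a)) rest) (pr n j)) (pr rest k)"
  using \<open>j \<le> k\<close>
proof (induction rule: inc_induct)
  case base
  have "reaches f (pr (pr (pr 14 (pr (code a) (pr n k))) rest) 0) (pr rest k)"
    by (rule reaches.step) (simp add: step_def reaches.refl)
  from reaches_trans[OF A[OF zero] this] show ?case
    by (intro reaches.step[of _ "pr (pr _ rest) _"]) (simp add: step_def Let_def)
next
  case (step j)
  obtain u where u: "eval f a (pr n j) = Some u" "u \<noteq> 0"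
    using pos[OF step.hyps(2)] by blast
  have "reaches f (pr (pr (pr 14 (pr (code a) (pr n j))) rest) u) (pr rest k)"
    using step.IH u(2) by (intro reaches.step[of _ "pr (pr _ rest) _"]) (simp add: step_def)
  from reaches_trans[OF A[OF u(1)] this] show ?case
    by (intro reaches.step[of _ "pr (pr _ rest) _"]) (simp add: step_def Let_def)
qed

lemma reaches_eval:
  "eval f e n = Some v \<Longrightarrow> reaches f (pr (pr (code e) rest) n) (pr rest v)"
proof (induction e arbitrary: n v rest)
  case (Pairing a b)
  then obtain u w where u: "eval f a n = Some u" and w: "eval f b n = Some w" and v: "v = pr u w"
    by (auto split: option.splits)
  have "reaches f (pr (pr (pr 11 u) rest) w) (pr rest v)"
    by (rule reaches.step) (simp add: step_def v reaches.refl)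
  with Pairing.IH(2)[OF w] have "reaches f (pr (pr (code b) (pr (pr 11 u) rest)) n) (pr rest v)"
    by (rule reaches_trans)
  then have "reaches f (pr (pr (pr 10 (pr (code b) n)) rest) u) (pr rest v)"
    by (intro reaches.step[of _ "pr (pr _ rest) _"]) (simp add: step_def)
  from reaches_trans[OF Pairing.IH(1)[OF u] this] show ?case
    by (intro reaches.step[of _ "pr (pr _ rest) _"]) (simp add: step_def)
next
  case (Compose a b)
  then obtain u where u: "eval f b n = Some u" "eval f a u = Some v"
    by (auto simp: bind_eq_Some_conv)
  show ?case
    using reaches_trans[OF Compose.IH(2)[OF u(1)] Compose.IH(1)[OF u(2)]]
    by (intro reaches.step[of _ "pr (pr _ rest) _"]) (simp add: step_def)
next
  case (PrimRec a b)
  obtain x k where n: "n = pr x k"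
    by (metis prod_decode_inverse surj_pair)
  from PrimRec show ?case
    unfolding n by (intro reaches_rec_nat) simp_all
next
  case (Minimise a)
  let ?Z = "\<lambda>k. eval f a (pr n k) = Some 0"
  obtain k where k: "?Z k" "\<And>j. j < k \<Longrightarrow> eval f a (pr n j) \<noteq> None" and v: "v = (LEAST k. ?Z k)"
    using Minimise.prems by (auto split: if_splits)
  have "\<exists>u. eval f a (pr n j) = Some u \<and> u \<noteq> 0" if "j < v" for j
  proof -
    have "v \<le> k"
      unfolding v by (rule Least_le[of ?Z, OF k(1)])
    then have "eval f a (pr n j) \<noteq> None"
      using that by (intro k(2)) simp
    moreover have "\<not> ?Z j"
      using not_less_Least[of j ?Z] that unfolding v by blast
    ultimately show ?thesis by auto
  qed
  then have "reaches f (pr (pr (pr 13 (code a)) rest) (pr n 0)) (pr rest v)"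
    using LeastI[of ?Z, OF k(1)] unfolding v[symmetric]
    by (intro reaches_search[OF Minimise.IH]) simp_all
  then show ?case
    by (intro reaches.step[of _ "pr (pr _ rest) _"]) (simp add: step_def)
qed (rule reaches.step, simp add: step_def reaches.refl)+

text \<open>\<open>J\<close> is meant to be a join of \<open>f\<close> with an embedded code:
  \<open>f\<close> sits at the even places, the code at place 1. The 0 is the empty stack.\<close>

definition run :: "baire \<Rightarrow> nat \<Rightarrow> nat \<Rightarrow> nat" where
  "run J n t = (step (\<lambda>m. J (2 * m)) ^^ t) (pr (pr (J 1) 0) n)"

lemma oracle_recursive_run: "oracle_recursive (\<lambda>J m. run J (lft m) (rgt m))"
proof -
  have funpow: "(h ^^ t) s = rec_nat s (\<lambda>_. h) t" for h :: "nat \<Rightarrow> nat" and t s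
    by (induction t) auto
  have "oracle_recursive (\<lambda>J m. step (\<lambda>m. J (2 * m)) (rgt (rgt m)))"
    unfolding step_def Let_def by (intro oracle_recursive_intros oracle_recursive_double)
  then show ?thesis
    unfolding run_def funpow by (intro oracle_recursive_intros)
qed

lemma step_halted: "lft (lft (lft s)) = 0 \<Longrightarrow> step f s = s"
  by (simp add: step_def)

lemma funpow_step_halted: "lft (lft (lft s)) = 0 \<Longrightarrow> (step f ^^ t) s = s"
  by (induction t) (simp_all add: step_halted)

lemma universal_functional:
  obtains U where "\<And>f e n v. eval f e n = Some v \<Longrightarrow>
    eval (turing_join f (nat_embed (code e))) U n = Some v"
proof -
  let ?tag = "\<lambda>J n t. lft (lft (lft (run J n t)))"
  have "oracle_recursive (\<lambda>J m. ?tag J (lft m) (rgt m))"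
    by (intro oracle_recursive_lft oracle_recursive_run)
  then obtain h where h: "\<And>J m. eval J h m = Some (?tag J (lft m) (rgt m))"
    unfolding oracle_recursive_def by blast
  have "oracle_recursive (\<lambda>J m. rgt (run J (lft m) (rgt m)))"
    by (intro oracle_recursive_rgt oracle_recursive_run)
  then obtain r where r: "\<And>J m. eval J r m = Some (rgt (run J (lft m) (rgt m)))"
    unfolding oracle_recursive_def by blast
  \<comment> \<open>\<open>Minimise h\<close> finds the first halting time, and \<open>r\<close>
    reads off the value at that time.\<close>
  let ?U = "Compose r (Pairing (Pairing Fst Snd) (Minimise h))"
  have "eval (turing_join f (nat_embed (code e))) ?U n = Some v" if v: "eval f e n = Some v" for f e n v
  proof -
    define J where "J = turing_join f (nat_embed (code e))"
    have J: "(\<lambda>m. J (2 * m)) = f" "J 1 = code e"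
      by (auto simp: J_def turing_join_def nat_embed_def)
    obtain t where t: "run J n t = pr 0 v"
      using reaches_imp_funpow[OF reaches_eval[OF v, of 0]] by (auto simp: run_def J[unfolded One_nat_def])
    have lft_0: "lft 0 = 0"
      by (metis pr_0_0 prod_encode_inverse fst_conv)
    have tag: "?tag J n t = 0"
      by (simp add: t lft_0)
    define s where "s = (LEAST k. ?tag J n k = 0)"
    have s: "?tag J n s = 0" "s \<le> t"
      unfolding s_def by (rule LeastI[of _ t], rule tag, rule Least_le, rule tag)
    \<comment> \<open>The least halting time \<open>s\<close> may precede \<open>t\<close>, but
      halted states are fixed by \<open>step\<close>, so the two states coincide.\<close>
    have "run J n t = (step f ^^ (t - s)) (run J n s)"
      using s(2) by (simp add: run_def J funpow_add[THEN fun_cong, unfolded comp_def, symmetric])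
    then have "run J n s = pr 0 v"
      using funpow_step_halted[OF s(1)] t by simp
    moreover have "eval J (Minimise h) n = Some s"
      using tag by (auto simp: h s_def)
    ultimately show ?thesis
      unfolding J_def[symmetric] by (simp add: r del: eval.simps(9))
  qed
  then show ?thesis using that by blast
qed

section \<open>Substitution for the oracle\<close>

primrec subst_oracle :: "index \<Rightarrow> index \<Rightarrow> index" where
  "subst_oracle d Zero = Zero"
| "subst_oracle d Succ = Succ"
| "subst_oracle d Fst = Fst"
| "subst_oracle d Snd = Snd"
| "subst_oracle d Oracle = d"
| "subst_oracle d (Pairing a b) = Pairing (subst_oracle d a) (subst_oracle d b)"
| "subst_oracle d (Compose a b) = Compose (subst_oracle d a) (subst_oracle d b)"
| "subst_oracle d (PrimRec a b) = PrimRec (subst_oracle d a) (subst_oracle d b)"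
| "subst_oracle d (Minimise a) = Minimise (subst_oracle d a)"

text \<open>As an equation of partial functions it also preserves undefinedness, so
  \<open>functional\<close> agrees on both sides.\<close>

lemma eval_subst_oracle:
  assumes "\<And>n. eval f d n = Some (g n)"
  shows "eval f (subst_oracle d e) = eval g e"
  by (induction e) (simp_all add: assms cong: if_cong)

text \<open>The number \<open>x\<close> is hard-wired as a constant. That \<open>d\<close> depends
  on it is harmless: \<open>computable_from\<close> allows a different functional for each
  \<open>f\<close>.\<close>

lemma turing_join_nat_embed_computable:
  obtains d where "\<And>f n. eval f d n = Some (turing_join f (nat_embed x) n)"
proof -
  have "oracle_recursive (\<lambda>f. turing_join f (nat_embed x))"
    unfolding turing_join_def nat_embed_def even_iff_mod_2_eq_zero
    by (intro oracle_recursive_intros oracle_recursive_mod2 oracle_recursive_div2)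
  then show ?thesis
    using that unfolding oracle_recursive_def by blast
qed

lemma computable_from_join_nat_embed:
  assumes "functional e (turing_join f (nat_embed x)) = Some k"
  shows "computable_from f k"
proof -
  obtain d where "\<And>f n. eval f d n = Some (turing_join f (nat_embed x) n)"
    using turing_join_nat_embed_computable by blast
  then have "functional (subst_oracle d e) f = functional e (turing_join f (nat_embed x))"
    by (simp add: functional_def eval_subst_oracle)
  then show ?thesis
    using assms unfolding computable_from_def turing_functional_def by metis
qed

lemma functional_eq_Some_iff: "functional e f = Some g \<longleftrightarrow> (\<forall>n. eval f e n = Some (g n))"
proof -
  have "eval f e n = Some (g n) \<longleftrightarrow> eval f e n \<noteq> None \<and> the (eval f e n) = g n" for n
    by auto
  then show ?thesis
    by (auto simp: functional_def fun_eq_iff)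
qed

theorem theorem1p6:
  fixes P :: problem
  shows "computably_true P \<longleftrightarrow> (\<exists>Q :: problem. first_order Q \<and> P \<le>\<^sub>W Q)"
proof
  assume P: "computably_true P"
  define Q :: problem where
    "Q f = {nat_embed (code e) | e. \<exists>k \<in> P f. functional e f = Some k}" for f
  obtain U where U: "\<And>f e n v. eval f e n = Some v \<Longrightarrow>
      eval (turing_join f (nat_embed (code e))) U n = Some v"
    using universal_functional by blast
  have "\<exists>h. functional Oracle f = Some h \<and> h \<in> instances Q \<and>
      (\<forall>g \<in> Q h. \<exists>k. functional U (turing_join f g) = Some k \<and> k \<in> P f)"
    if "f \<in> instances P" for f
  proof (rule exI[of _ f], intro conjI ballI)
    show "functional Oracle f = Some f"
      by (simp add: functional_eq_Some_iff)
    \<comment> \<open>Computable truth enters here: an index computing a solution from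
      \<open>f\<close> makes \<open>Q f\<close> nonempty.\<close>
    show "f \<in> instances Q"
      using P that unfolding computably_true_def computable_from_def turing_functional_def
        instances_def Q_def by blast
    show "\<exists>k. functional U (turing_join f g) = Some k \<and> k \<in> P f" if "g \<in> Q f" for g
      using that U by (fastforce simp: Q_def functional_eq_Some_iff)
  qed
  then have "P \<le>\<^sub>W Q"
    unfolding weihrauch_le_def turing_functional_def by blast
  moreover have "first_order Q"
    by (auto simp: first_order_def Q_def)
  ultimately show "\<exists>Q. first_order Q \<and> P \<le>\<^sub>W Q" by blast
next
  assume "\<exists>Q. first_order Q \<and> P \<le>\<^sub>W Q"
  then obtain Q \<Phi> e where Q: "first_order Q"
    and red: "\<And>f. f \<in> instances P \<Longrightarrow> \<exists>h. \<Phi> f = Some h \<and> h \<in> instances Q \<and>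
      (\<forall>g \<in> Q h. \<exists>k. functional e (turing_join f g) = Some k \<and> k \<in> P f)"
    unfolding weihrauch_le_def turing_functional_def by blast
  show "computably_true P"
    unfolding computably_true_def
  proof
    fix f assume "f \<in> instances P"
    then obtain h where h: "h \<in> instances Q"
      and sol: "\<And>g. g \<in> Q h \<Longrightarrow> \<exists>k. functional e (turing_join f g) = Some k \<and> k \<in> P f"
      using red by blast
    obtain x where "nat_embed x \<in> Q h"
      using Q h unfolding first_order_def instances_def by blast
    then show "\<exists>k \<in> P f. computable_from f k"
      using sol computable_from_join_nat_embed by blast
  qed
qed

end
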